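(* As $t\to+\infty$ ($t$ real), the alternating Hurwitz zeta function has the (divergent) asymptotic series representation $$\eta\bigl(1,(t+1)/2\bigr)\sim\sum_{k=0}^{\infty}\frac{\mathcal{E}(2k)}{t^{2k+1}},$$ that is, for every integer $M\geq 0$, $$\eta\bigl(1,(t+1)/2\bigr)-\sum_{k=0}^{M}\frac{\mathcal{E}(2k)}{t^{2k+1}}=o\bigl(t^{-2M-1}\bigr)\qquad (t\to+\infty).$$
   Context: $\eta(s,a)=\sum_{k=0}^{\infty}(-1)^k/(k+a)^s$ is the alternating Hurwitz zeta function, so that $2\,\eta(1,(t+1)/2)=\psi\bigl(\tfrac t4+\tfrac34\bigr)-\psi\bigl(\tfrac t4+\tfrac14\bigr)$ with $\psi$ the digamma function. $\mathcal{E}(n)$ denotes the $n$-th Euler number, $1/\cosh x=\sum_{n\ge0}\mathcal{E}(n)x^n/n!$ (so $\mathcal{E}(0)=1$, $\mathcal{E}(2)=-1$, $\mathcal{E}(4)=5$). *)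

theory Defs
  imports "HOL-Analysis.Analysis" "HOL-Library.Landau_Symbols"
begin

text \<open>
  The alternating Hurwitz zeta function, usable over the reals and the complex numbers. The series
  is summed in its natural order, since at \<open>s = 1\<close> it converges only conditionally. Over the reals
  the definition is meaningful for \<open>a > 0\<close>, where \<open>powr\<close> is the genuine power.
\<close>
definition alt_hurwitz_zeta :: "'a \<Rightarrow> 'a \<Rightarrow> 'a::{real_normed_field, ln}" where
  "alt_hurwitz_zeta s a = (\<Sum>k. (-1) ^ k / (of_nat k + a) powr s)"

definition fps_cosh :: "real fps" where
  "fps_cosh = fps_const (1/2) * (fps_exp 1 + fps_exp (-1))"

text \<open>
  Signed Euler numbers with exponential generating function \<open>1 / cosh x\<close>; lemma
  \<open>euler_number_generating_function\<close> gives the analytic reading of this definition.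
\<close>
definition euler_number :: "nat \<Rightarrow> real" where
  "euler_number n = fact n * fps_nth (inverse fps_cosh) n"

lemma fps_cosh_nth_0: "fps_nth fps_cosh 0 = 1"
  by (simp add: fps_cosh_def)

lemma euler_number_generating_function:
  "eventually (\<lambda>x::real. (\<lambda>n. euler_number n * x ^ n / fact n) sums (1 / cosh x)) (nhds 0)"
proof -
  have "(\<lambda>x::real. 1/2 * (exp (1 * x) + exp (- 1 * x))) has_fps_expansion fps_cosh"
    unfolding fps_cosh_def by (intro fps_expansion_intros)
  also have "(\<lambda>x::real. 1/2 * (exp (1 * x) + exp (- 1 * x))) = cosh"
    by (simp add: fun_eq_iff cosh_def)
  finally have "cosh has_fps_expansion fps_cosh" .
  then have exp: "(\<lambda>x. inverse (cosh x)) has_fps_expansion inverse fps_cosh"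
    by (rule has_fps_expansion_inverse) (simp add: fps_cosh_nth_0)
  then have pos: "fps_conv_radius (inverse fps_cosh) > 0"
    and ev: "eventually (\<lambda>x. eval_fps (inverse fps_cosh) x = inverse (cosh x)) (nhds 0)"
    by (auto simp: has_fps_expansion_def)
  have "eventually (\<lambda>x::real. x \<in> eball 0 (fps_conv_radius (inverse fps_cosh))) (nhds 0)"
    using pos by (intro eventually_nhds_in_open) (auto simp: zero_ereal_def)
  with ev show ?thesis
  proof eventually_elim
    case (elim x)
    then have "(\<lambda>n. fps_nth (inverse fps_cosh) n * x ^ n) sums eval_fps (inverse fps_cosh) x"
      by (intro sums_eval_fps) auto
    with elim show ?case
      by (simp add: euler_number_def inverse_eq_divide)
  qed
qed

lemma euler_number_initial_values:
  "euler_number 0 = 1" "euler_number 2 = -1" "euler_number 4 = 5"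
  by (simp_all add: euler_number_def fps_cosh_def fps_inverse_def eval_nat_numeral fact_numeral)

lemma summable_alt_hurwitz_zeta:
  fixes s a :: real
  assumes "s > 0" "a > 0"
  shows "summable (\<lambda>k. (-1) ^ k / (of_nat k + a) powr s)"
proof -
  have "summable (\<lambda>k. (-1) ^ k * (1 / (of_nat k + a) powr s))"
  proof (rule summable_Leibniz(1))
    have "filterlim (\<lambda>k. of_nat k + a) at_top sequentially"
      by (subst add.commute, rule filterlim_tendsto_add_at_top[OF tendsto_const filterlim_real_sequentially])
    then have "((\<lambda>k. (of_nat k + a) powr (-s)) \<longlongrightarrow> 0) sequentially"
      using assms by (intro tendsto_neg_powr) auto
    then show "(\<lambda>k. 1 / (of_nat k + a) powr s) \<longlonglongrightarrow> 0"
      by (simp add: powr_minus_divide)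
    show "monoseq (\<lambda>k. 1 / (of_nat k + a) powr s)"
      using assms by (intro decseq_imp_monoseq) (auto simp: decseq_def intro!: divide_left_mono powr_mono2)
  qed
  then show ?thesis by simp
qed

end

theory Submission
  imports Defs
begin

text \<open>
  Put \<open>S(t) = \<eta>(1, (t + 1)/2) = 2/(t + 1) - 2/(t + 3) + 2/(t + 5) - \<dots>\<close>. Dropping the first term of this
  series gives \<open>S(t - 1) + S(t + 1) = 2/t\<close>, and together with \<open>S(t) \<longlongrightarrow> 0\<close> this difference equation
  determines \<open>S\<close>. The asymptotic expansion is proved by showing that the partial sum
  \<open>P(t) = \<E>(0)/t + \<dots> + \<E>(2M)/t^(2M+1)\<close> almost solves the same equation.

  In the variable \<open>x = 1/t\<close>, the shifts \<open>t \<mp> 1\<close> become \<open>x/(1 \<mp> x)\<close>, and by the binomial series the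
  coefficient of \<open>x^(i+1)\<close> in \<open>P(t - 1) + P(t + 1)\<close> is the sum over \<open>k \<le> M\<close> of
  \<open>(i choose 2k) \<E>(2k) (1 + (-1)^i)\<close>. This vanishes for odd \<open>i\<close>; for even \<open>i \<le> 2M\<close> it equals \<open>2\<close> if
  \<open>i = 0\<close> and \<open>0\<close> otherwise, which is exactly the recurrence of the Euler numbers expressed by
  \<open>(1 / cosh) * cosh = 1\<close> (\<open>euler_number_recurrence\<close>). Hence the defect
  \<open>2/t - P(t - 1) - P(t + 1)\<close> is \<open>O(t^-(2M+3))\<close> (\<open>euler_partial_sum_defect_bigo\<close>).

  The error \<open>R = S - P\<close> therefore tends to \<open>0\<close> and satisfies \<open>R(t) + R(t + 2) = O(t^-(2M+3))\<close>.
  Comparing \<open>\<bar>R\<bar>\<close> with a multiple of \<open>t^-(2M+2)\<close>, whose own differences over steps of length \<open>2\<close>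
  dominate the right-hand side, yields \<open>R(t) = O(t^-(2M+2))\<close>
  (\<open>decay_of_alternating_difference_equation\<close>), which is \<open>o(t^-(2M+1))\<close>.

  Divergence comes from the pole of \<open>1 / cosh\<close> at \<open>i\<pi>/2\<close>: convergence at a single \<open>t\<close> would bound
  \<open>\<E>(2k)\<close> geometrically and so make the Taylor series of \<open>1 / cosh\<close> converge everywhere. On the
  imaginary axis this reads as a power series whose product with \<open>cos y\<close> is \<open>1\<close>, contradicting
  \<open>cos (\<pi>/2) = 0\<close> (\<open>not_summable_euler_series\<close>).
\<close>

section \<open>Euler numbers and divergence of the series\<close>

lemma fps_cosh_nth: "fps_nth fps_cosh n = (if even n then 1 / fact n else 0)"
  by (simp add: fps_cosh_def field_simps)

text \<open>
  The coefficient of \<open>x^(2n)\<close> in \<open>(1 / cosh x) * cosh x = 1\<close>. Only even indices contribute, since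
  \<open>cosh\<close> has no odd coefficients and the total degree is even.
\<close>
lemma euler_number_recurrence:
  "(\<Sum>k\<le>n. real ((2 * n) choose (2 * k)) * euler_number (2 * k)) = (if n = 0 then 1 else 0)"
proof -
  let ?e = "inverse fps_cosh"
  let ?h = "\<lambda>i. real ((2 * n) choose i) * euler_number i"
  have "?e * fps_cosh = 1"
    by (intro inverse_mult_eq_1) (simp add: fps_cosh_nth_0)
  then have "(if n = 0 then 1 else 0) = fact (2 * n) * fps_nth (?e * fps_cosh) (2 * n)"
    by simp
  also have "\<dots> = (\<Sum>i\<le>2 * n. if even i then ?h i else 0)"
    unfolding fps_mult_nth atLeast0AtMost sum_distrib_left
    by (intro sum.cong) (auto simp: fps_cosh_nth euler_number_def binomial_fact)
  also have "\<dots> = (\<Sum>i \<in> (\<lambda>k. 2 * k) ` {..n}. ?h i)"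
    by (rule sum.mono_neutral_cong_right) (auto elim!: evenE)
  also have "\<dots> = (\<Sum>k\<le>n. ?h (2 * k))"
    by (simp add: sum.reindex inj_on_def)
  finally show ?thesis by simp
qed

text \<open>
  The series \<open>a\<close> in the proof is the Taylor series of \<open>1 / cosh\<close> at the point \<open>iy\<close> with \<open>y = \<pi>/2\<close>,
  rewritten over the reals, and \<open>b\<close> is the cosine series at \<open>y\<close>. By \<open>euler_number_recurrence\<close> their
  Cauchy product is \<open>1, 0, 0, \<dots>\<close>, although \<open>b\<close> sums to \<open>0\<close>. The assumed convergence enters only
  through the bound on its terms that makes \<open>a\<close> absolutely summable.
\<close>
lemma not_summable_euler_series:
  fixes t :: real
  assumes "t > 0"
  shows "\<not> summable (\<lambda>k. euler_number (2 * k) / t ^ (2 * k + 1))"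
proof
  assume sm: "summable (\<lambda>k. euler_number (2 * k) / t ^ (2 * k + 1))"
  then have "Bseq (\<lambda>k. euler_number (2 * k) / t ^ (2 * k + 1))"
    by (intro convergent_imp_Bseq convergentI[of _ 0] summable_LIMSEQ_zero)
  then obtain C where C: "\<And>k. \<bar>euler_number (2 * k) / t ^ (2 * k + 1)\<bar> \<le> C"
    by (auto simp: Bseq_def)
  have bound: "\<bar>euler_number (2 * k)\<bar> \<le> C * t * t ^ (2 * k)" for k
    using C[of k] assms by (simp add: abs_div divide_simps mult_ac)
  define y :: real where "y = pi / 2"
  define a where "a = (\<lambda>k. (-1) ^ k * euler_number (2 * k) / fact (2 * k) * y ^ (2 * k))"
  define b where "b = (\<lambda>k. (-1) ^ k / fact (2 * k) * y ^ (2 * k))"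
  have ev: "summable (\<lambda>k. inverse (fact (2 * k)) * x ^ (2 * k))" if "x \<ge> 0" for x :: real
    using summable_reindex[OF summable_exp[of x], of "\<lambda>k. 2 * k"] that
    by (simp add: inj_on_def o_def)
  have y: "y \<ge> 0" by (simp add: y_def)
  have sa: "summable (\<lambda>k. norm (a k))"
  proof (rule summable_comparison_test)
    show "summable (\<lambda>k. C * t * (inverse (fact (2 * k)) * (t * y) ^ (2 * k)))"
      using assms y by (intro summable_mult ev) auto
    have "norm (norm (a k)) \<le> C * t * (inverse (fact (2 * k)) * (t * y) ^ (2 * k))" for k
    proof -
      have "norm (norm (a k)) = \<bar>euler_number (2 * k)\<bar> * (inverse (fact (2 * k)) * y ^ (2 * k))"
        using y by (simp add: a_def abs_mult power_abs divide_inverse)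
      also have "\<dots> \<le> C * t * t ^ (2 * k) * (inverse (fact (2 * k)) * y ^ (2 * k))"
        using bound y by (intro mult_right_mono) auto
      finally show ?thesis by (simp add: power_mult_distrib mult_ac)
    qed
    then show "\<exists>N. \<forall>n\<ge>N. norm (norm (a n)) \<le> C * t * (inverse (fact (2 * n)) * (t * y) ^ (2 * n))"
      by blast
  qed
  have sb: "summable (\<lambda>k. norm (b k))"
    using ev[OF y] y by (simp add: b_def abs_mult power_abs divide_inverse)
  have "(\<Sum>i\<le>k. a i * b (k - i)) = (if k = 0 then 1 else 0)" for k
  proof -
    have "(\<Sum>i\<le>k. a i * b (k - i)) =
        (\<Sum>i\<le>k. (-1) ^ k * y ^ (2 * k) / fact (2 * k)
          * (real ((2 * k) choose (2 * i)) * euler_number (2 * i)))"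
    proof (intro sum.cong refl)
      fix i assume "i \<in> {..k}"
      then obtain j where "k = i + j" by (auto simp: le_iff_add)
      then show "a i * b (k - i) = (-1) ^ k * y ^ (2 * k) / fact (2 * k)
          * (real ((2 * k) choose (2 * i)) * euler_number (2 * i))"
        by (simp add: a_def b_def binomial_fact power_add divide_simps distrib_left)
    qed
    also have "\<dots> = (-1) ^ k * y ^ (2 * k) / fact (2 * k) * (if k = 0 then 1 else 0)"
      by (simp only: sum_distrib_left[symmetric] euler_number_recurrence)
    finally show ?thesis by simp
  qed
  with Cauchy_product[OF sa sb] have "(\<Sum>k. a k) * (\<Sum>k. b k) = (\<Sum>k. if k = 0 then 1 else 0)"
    by simp
  also have "\<dots> = 1"
    using suminf_finite[of "{0}" "\<lambda>k::nat. if k = 0 then 1 else (0::real)"] by simp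
  finally have "(\<Sum>k. a k) * (\<Sum>k. b k) = 1" .
  moreover have "(\<Sum>k. b k) = 0"
    using sums_unique[OF cos_paired[of y]] by (simp add: b_def y_def)
  ultimately show False by simp
qed

section \<open>The difference equation\<close>

lemma
  fixes a :: real
  assumes "a > 0"
  shows alt_hurwitz_zeta_one_shift: "alt_hurwitz_zeta 1 a + alt_hurwitz_zeta 1 (a + 1) = 1 / a"
    and alt_hurwitz_zeta_one_nonneg: "alt_hurwitz_zeta 1 a \<ge> 0"
proof -
  have eq: "alt_hurwitz_zeta 1 c = (\<Sum>k. (-1) ^ k * (1 / (real k + c)))" if "c > 0" for c :: real
    unfolding alt_hurwitz_zeta_def using that by (intro suminf_cong) simp
  have sm: "summable (\<lambda>k. (-1) ^ k * (1 / (real k + a)))"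
    using summable_alt_hurwitz_zeta[of 1 a] assms by simp
  have "alt_hurwitz_zeta 1 (a + 1) = (\<Sum>k. - ((-1) ^ Suc k * (1 / (real (Suc k) + a))))"
    using assms by (subst eq) (auto intro!: suminf_cong simp: add_ac)
  also have "\<dots> = - (\<Sum>k. (-1) ^ Suc k * (1 / (real (Suc k) + a)))"
    by (rule suminf_minus) (rule iffD2[OF summable_Suc_iff sm])
  also have "\<dots> = 1 / a - alt_hurwitz_zeta 1 a"
    using suminf_split_head[OF sm] eq[OF assms] by simp
  finally show "alt_hurwitz_zeta 1 a + alt_hurwitz_zeta 1 (a + 1) = 1 / a" by simp
  have "filterlim (\<lambda>k. a + real k) at_top sequentially"
    by (rule filterlim_tendsto_add_at_top[OF tendsto_const filterlim_real_sequentially])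
  then have "(\<lambda>k. 1 / (real k + a)) \<longlonglongrightarrow> 0"
    by (intro real_tendsto_divide_at_top[OF tendsto_const]) (simp add: add.commute)
  from summable_Leibniz'(2)[OF this, of 0] assms
  show "alt_hurwitz_zeta 1 a \<ge> 0"
    by (auto simp: eq field_simps)
qed

lemma alt_hurwitz_zeta_one_tendsto_0: "(alt_hurwitz_zeta 1 \<longlongrightarrow> (0::real)) at_top"
proof (rule tendsto_sandwich)
  show "eventually (\<lambda>a::real. 0 \<le> alt_hurwitz_zeta 1 a) at_top"
    using eventually_gt_at_top[of 0] by eventually_elim (rule alt_hurwitz_zeta_one_nonneg)
  show "eventually (\<lambda>a::real. alt_hurwitz_zeta 1 a \<le> 1 / a) at_top"
    using eventually_gt_at_top[of 0]
  proof eventually_elim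
    case (elim a)
    then show ?case
      using alt_hurwitz_zeta_one_shift[of a] alt_hurwitz_zeta_one_nonneg[of "a + 1"] by simp
  qed
  show "((\<lambda>a::real. 1 / a) \<longlongrightarrow> 0) at_top"
    by (intro real_tendsto_divide_at_top[OF tendsto_const] filterlim_ident)
qed auto

text \<open>
  The quantity \<open>t^-(n+1)\<close> drops over a step of length \<open>2\<close> by at least what its derivative at the
  midpoint suggests, up to the factor \<open>n + 1\<close>. Centring at \<open>t + 1\<close> rests on \<open>t (t + 2) \<le> (t + 1)^2\<close>
  and matches the argument of \<open>g\<close> in the next lemma.
\<close>
lemma inverse_power_diff_lower_bound:
  fixes t :: real
  assumes "t > 0"
  shows "1 / t ^ Suc n - 1 / (t + 2) ^ Suc n \<ge> 2 / (t + 1) ^ (n + 2)"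
proof -
  have "2 / (t + 1) ^ 2 \<le> 2 / (t * (t + 2))"
    using assms by (intro divide_left_mono mult_pos_pos zero_less_power)
      (auto simp: power2_eq_square algebra_simps)
  moreover have "1 / (t + 1) ^ n \<le> 1 / t ^ n"
    using assms by (intro divide_left_mono power_mono) auto
  moreover have "2 / (t + 1) ^ (n + 2) = 2 / (t + 1) ^ 2 * (1 / (t + 1) ^ n)"
    by (simp add: power_add power2_eq_square)
  ultimately have "2 / (t + 1) ^ (n + 2) \<le> 2 / (t * (t + 2)) * (1 / t ^ n)"
    using assms by (simp only:) (intro mult_mono, auto)
  also have "\<dots> = 1 / t * (1 / t ^ n) - 1 / (t + 2) * (1 / t ^ n)"
    using assms by (simp add: divide_simps)
  also have "\<dots> \<le> 1 / t * (1 / t ^ n) - 1 / (t + 2) * (1 / (t + 2) ^ n)"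
    using assms by (intro diff_left_mono mult_left_mono divide_left_mono power_mono) auto
  finally show ?thesis by simp
qed

text \<open>
  A barrier argument. Along \<open>t, t + 2, t + 4, \<dots>\<close> the excess \<open>D\<close> of \<open>\<bar>R\<bar>\<close> over the barrier
  \<open>C/2 * t^-(n+1)\<close> never decreases, because the barrier drops by at least \<open>\<bar>g (t + 1)\<bar>\<close> at each step.
  Since \<open>D\<close> tends to \<open>0\<close>, it is nowhere positive.
\<close>
lemma decay_of_alternating_difference_equation:
  fixes R g :: "real \<Rightarrow> real"
  assumes lim: "(R \<longlongrightarrow> 0) at_top"
    and eq: "\<And>t. t \<ge> T \<Longrightarrow> R t + R (t + 2) = g (t + 1)"
    and g: "\<And>t. t \<ge> T \<Longrightarrow> \<bar>g t\<bar> \<le> C / t ^ (n + 2)"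
    and "T > 0" "t \<ge> T"
  shows "\<bar>R t\<bar> \<le> C / 2 / t ^ Suc n"
proof -
  define D where "D = (\<lambda>t. \<bar>R t\<bar> - C / 2 / t ^ Suc n)"
  \<comment> \<open>the bound on \<open>g\<close> at a single point already forces \<open>C\<close> to be nonnegative\<close>
  have "0 \<le> \<bar>g T\<bar> * T ^ (n + 2)"
    using \<open>T > 0\<close> by simp
  also have "\<dots> \<le> C"
    using g[of T] \<open>T > 0\<close> by (simp add: field_simps)
  finally have "C \<ge> 0" .
  have step: "D s \<le> D (s + 2)" if "s \<ge> T" for s
  proof -
    have "\<bar>R s\<bar> \<le> \<bar>R (s + 2)\<bar> + \<bar>g (s + 1)\<bar>"
      using eq[OF that] by linarith
    also have "\<bar>g (s + 1)\<bar> \<le> C / 2 * (2 / (s + 1) ^ (n + 2))"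
      using g[of "s + 1"] that by simp
    also have "\<dots> \<le> C / 2 * (1 / s ^ Suc n - 1 / (s + 2) ^ Suc n)"
      using that \<open>T > 0\<close> \<open>C \<ge> 0\<close>
      by (intro mult_left_mono inverse_power_diff_lower_bound) auto
    finally show ?thesis by (simp add: D_def right_diff_distrib)
  qed
  have le: "D t \<le> D (t + 2 * real k)" for k
  proof (induction k)
    case (Suc k)
    have "D (t + 2 * real k) \<le> D (t + 2 * real k + 2)"
      using \<open>t \<ge> T\<close> by (intro step) simp
    with Suc.IH show ?case by (simp add: algebra_simps)
  qed simp
  have "(D \<longlongrightarrow> \<bar>0\<bar> - 0) at_top"
    unfolding D_def
    by (intro tendsto_diff tendsto_rabs lim real_tendsto_divide_at_top[OF tendsto_const]
        filterlim_pow_at_top filterlim_ident) auto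
  moreover have "filterlim (\<lambda>k. t + 2 * real k) at_top sequentially"
    by (intro filterlim_tendsto_add_at_top[OF tendsto_const]
        filterlim_tendsto_pos_mult_at_top[OF tendsto_const] filterlim_real_sequentially) simp
  ultimately have "(\<lambda>k. D (t + 2 * real k)) \<longlonglongrightarrow> 0"
    using filterlim_compose by fastforce
  then have "D t \<le> 0"
    by (rule LIMSEQ_le_const) (use le in blast)
  then show ?thesis by (simp add: D_def)
qed

section \<open>The partial sums almost solve the difference equation\<close>

text \<open>
  The partial sums are taken in the variable \<open>x = 1/t\<close>, so that their behaviour as \<open>t \<longlongrightarrow> \<infinity>\<close> can be
  read off from power series at \<open>0\<close>.
\<close>
definition euler_partial_sum :: "nat \<Rightarrow> real \<Rightarrow> real" where
  "euler_partial_sum M x = (\<Sum>k\<le>M. euler_number (2 * k) * x ^ (2 * k + 1))"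

lemma has_fps_expansion_power [fps_expansion_intros]:
  fixes F :: "'a :: {banach, real_normed_field} fps"
  assumes "f has_fps_expansion F"
  shows "(\<lambda>x. f x ^ n) has_fps_expansion F ^ n"
  by (induction n) (auto intro!: fps_expansion_intros assms)

lemma has_fps_expansion_power_div:
  fixes c :: real
  shows "(\<lambda>x. (x / (1 - c * x)) ^ Suc m) has_fps_expansion
    fps_X ^ Suc m * Abs_fps (\<lambda>j. real ((m + j) choose j) * c ^ j)"
proof -
  have "(\<lambda>x::real. x ^ Suc m * inverse ((1 - c * x) ^ Suc m)) has_fps_expansion
      fps_X ^ Suc m * inverse ((1 - fps_const c * fps_X) ^ Suc m)"
    by (intro fps_expansion_intros) (simp add: fps_power_zeroth)
  moreover have "(\<lambda>x. (x / (1 - c * x)) ^ Suc m) = (\<lambda>x. x ^ Suc m * inverse ((1 - c * x) ^ Suc m))"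
    by (simp only: power_mult_distrib power_inverse divide_inverse)
  ultimately show ?thesis
    by (simp add: one_minus_const_fps_X_neg_power' del: power_Suc)
qed

lemma has_fps_expansion_imp_bigo:
  fixes F :: "real fps"
  assumes f: "f has_fps_expansion F" and 0: "\<And>j. j < n \<Longrightarrow> fps_nth F j = 0"
  shows "f \<in> O[at 0](\<lambda>x. x ^ n)"
proof (cases "F = 0")
  case True
  then have "eventually (\<lambda>x. f x = 0) (nhds 0)"
    using f by (auto simp: has_fps_expansion_def elim: eventually_mono)
  then have "eventually (\<lambda>x. f x = 0) (at 0)"
    by (rule filter_leD[OF at_within_le_nhds])
  then have "eventually (\<lambda>x. norm (f x) \<le> 0 * norm (x ^ n)) (at 0)"
    by eventually_elim simp
  then show ?thesis
    by (rule bigoI)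
next
  case False
  then have "n \<le> subdegree F"
    using 0 by (intro subdegree_geI) auto
  then have "(\<lambda>x. if x = 0 then fps_nth F n else f x / x ^ n) has_fps_expansion fps_shift n F"
    using f by (intro has_fps_expansion_shift) auto
  from has_fps_expansion_imp_continuous[OF this, of UNIV]
  have "((\<lambda>x. if x = 0 then fps_nth F n else f x / x ^ n) \<longlongrightarrow> fps_nth F n) (at 0)"
    by (simp add: continuous_within)
  then have "((\<lambda>x. f x / x ^ n) \<longlongrightarrow> fps_nth F n) (at 0)"
    by (rule Lim_transform_eventually) (auto simp: eventually_at_filter)
  then show ?thesis
    by (rule bigoI_tendsto) (rule eventually_mono[OF eventually_neq_at_within[of 0]], simp)
qed

text \<open>
  With \<open>x = 1/t\<close>, the arguments \<open>x/(1 - x)\<close> and \<open>x/(1 + x)\<close> are \<open>1/(t - 1)\<close> and \<open>1/(t + 1)\<close>. In the sum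
  of the two shifted partial sums, odd powers of \<open>\<mp>1\<close> cancel, which disposes of the coefficients of
  even powers of \<open>x\<close>; those of the odd powers up to \<open>x^(2M+1)\<close> are given by
  \<open>euler_number_recurrence\<close>. As \<open>x^(2M+2)\<close> is even, the first surviving power is \<open>x^(2M+3)\<close>.
\<close>
lemma euler_partial_sum_defect_bigo:
  "(\<lambda>x. 2 * x - euler_partial_sum M (x / (1 - x)) - euler_partial_sum M (x / (1 + x)))
    \<in> O[at 0](\<lambda>x. x ^ (2 * M + 3))"
proof (rule has_fps_expansion_imp_bigo)
  \<comment> \<open>the expansion of the partial sum at \<open>x/(1 - c x)\<close>, used for \<open>c = 1\<close> and \<open>c = -1\<close>\<close>
  define G where "G = (\<lambda>c. \<Sum>k\<le>M. fps_const (euler_number (2 * k)) *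
      (fps_X ^ Suc (2 * k) * Abs_fps (\<lambda>j. real ((2 * k + j) choose j) * c ^ j)))"
  have G: "(\<lambda>x. euler_partial_sum M (x / (1 - c * x))) has_fps_expansion G c" for c
    unfolding euler_partial_sum_def G_def Suc_eq_plus1[symmetric]
    by (intro fps_expansion_intros has_fps_expansion_power_div)
  have "(\<lambda>x. 2 * x - euler_partial_sum M (x / (1 - 1 * x)) - euler_partial_sum M (x / (1 - (- 1) * x)))
      has_fps_expansion fps_const 2 * fps_X - G 1 - G (- 1)"
    by (intro fps_expansion_intros G)
  then show "(\<lambda>x. 2 * x - euler_partial_sum M (x / (1 - x)) - euler_partial_sum M (x / (1 + x)))
      has_fps_expansion fps_const 2 * fps_X - G 1 - G (- 1)"
    by simp
  fix j :: nat assume j: "j < 2 * M + 3"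
  have G_nth: "fps_nth (G c) (Suc i) =
      (\<Sum>k\<le>M. euler_number (2 * k) * (real (i choose (2 * k)) * c ^ (i - 2 * k)))" for c i
    unfolding G_def fps_sum_nth
  proof (intro sum.cong refl)
    fix k
    show "fps_nth (fps_const (euler_number (2 * k)) *
        (fps_X ^ Suc (2 * k) * Abs_fps (\<lambda>j. real ((2 * k + j) choose j) * c ^ j))) (Suc i) =
        euler_number (2 * k) * (real (i choose (2 * k)) * c ^ (i - 2 * k))"
      using binomial_symmetric[of "2 * k" i]
      by (auto simp: fps_X_power_mult_nth binomial_eq_0 simp del: power_Suc)
  qed
  show "fps_nth (fps_const 2 * fps_X - G 1 - G (- 1)) j = 0"
  proof (cases j)
    case 0
    then show ?thesis
      by (simp add: G_def fps_sum_nth fps_X_power_mult_nth del: power_Suc)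
  next
    case (Suc i)
    have "fps_nth (G 1) j + fps_nth (G (- 1)) j = (if i = 0 then 2 else 0)"
    proof (cases "even i")
      case True
      then obtain N where N: "i = 2 * N" by (elim evenE)
      then have "N \<le> M" using j Suc by simp
      \<comment> \<open>\<open>N \<le> M\<close> ensures that no term of the recurrence is cut off by the truncation at \<open>M\<close>\<close>
      have "fps_nth (G 1) j + fps_nth (G (- 1)) j =
          2 * (\<Sum>k\<le>M. real (i choose (2 * k)) * euler_number (2 * k))"
        unfolding Suc G_nth sum.distrib[symmetric] sum_distrib_left
        using N by (intro sum.cong) auto
      also have "(\<Sum>k\<le>M. real (i choose (2 * k)) * euler_number (2 * k)) =
          (\<Sum>k\<le>N. real ((2 * N) choose (2 * k)) * euler_number (2 * k))"
        using \<open>N \<le> M\<close> N by (intro sum.mono_neutral_cong_right) (auto simp: binomial_eq_0)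
      finally show ?thesis
        using N by (simp add: euler_number_recurrence)
    next
      case False
      have "fps_nth (G 1) j + fps_nth (G (- 1)) j = 0"
        unfolding Suc G_nth sum.distrib[symmetric]
      proof (rule sum.neutral, intro ballI)
        fix k
        show "euler_number (2 * k) * (real (i choose (2 * k)) * 1 ^ (i - 2 * k)) +
            euler_number (2 * k) * (real (i choose (2 * k)) * (- 1) ^ (i - 2 * k)) = 0"
          using False by (cases "2 * k \<le> i") (auto simp: binomial_eq_0)
      qed
      with False show ?thesis by (cases i) auto
    qed
    then show ?thesis
      using Suc by (simp add: fps_X_nth algebra_simps)
  qed
qed

lemma euler_partial_sum_defect_bound:
  obtains T C where "T > 1"
    "\<forall>t\<ge>T. \<bar>2 / t - euler_partial_sum M (1 / (t - 1)) - euler_partial_sum M (1 / (t + 1))\<bar> \<le> C / t ^ (2 * M + 3)"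
proof -
  let ?h = "\<lambda>x. 2 * x - euler_partial_sum M (x / (1 - x)) - euler_partial_sum M (x / (1 + x))"
  obtain C where "eventually (\<lambda>x. norm (?h x) \<le> C * norm (x ^ (2 * M + 3))) (at 0)"
    using euler_partial_sum_defect_bigo[of M] by (elim landau_o.bigE)
  then have "eventually (\<lambda>x. norm (?h x) \<le> C * norm (x ^ (2 * M + 3))) (at_right 0)"
    by (auto simp: eventually_at_split)
  then have "eventually (\<lambda>t. norm (?h (inverse t)) \<le> C * norm (inverse t ^ (2 * M + 3))) at_top"
    by (simp add: eventually_at_right_to_top)
  then obtain T where T: "\<And>t. t \<ge> T \<Longrightarrow>
      norm (?h (inverse t)) \<le> C * norm (inverse t ^ (2 * M + 3))"
    by (auto simp: eventually_at_top_linorder)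
  have "\<forall>t\<ge>max T 2.
      \<bar>2 / t - euler_partial_sum M (1 / (t - 1)) - euler_partial_sum M (1 / (t + 1))\<bar> \<le> C / t ^ (2 * M + 3)"
  proof (intro allI impI)
    fix t assume t: "t \<ge> max T 2"
    have "inverse t / (1 - inverse t) = 1 / (t - 1)" "inverse t / (1 + inverse t) = 1 / (t + 1)"
      using t by (auto simp: field_simps)
    with T[of t] t
    show "\<bar>2 / t - euler_partial_sum M (1 / (t - 1)) - euler_partial_sum M (1 / (t + 1))\<bar> \<le> C / t ^ (2 * M + 3)"
      by (simp add: divide_inverse power_inverse abs_mult power_abs del: power_Suc)
  qed
  then show thesis
    by (rule that[rotated]) simp
qed

section \<open>The asymptotic expansion\<close>

lemma alt_hurwitz_zeta_one_euler_bound: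
  obtains T C where "T > 1"
    "\<forall>t\<ge>T. \<bar>alt_hurwitz_zeta 1 ((t + 1) / 2) - euler_partial_sum M (1 / t)\<bar> \<le> C / t ^ (2 * M + 2)"
proof -
  obtain T C where "T > 1" and CT: "\<forall>t\<ge>T.
    \<bar>2 / t - euler_partial_sum M (1 / (t - 1)) - euler_partial_sum M (1 / (t + 1))\<bar> \<le> C / t ^ (2 * M + 3)"
    by (rule euler_partial_sum_defect_bound[where M = M])
  define R where "R = (\<lambda>t. alt_hurwitz_zeta 1 ((t + 1) / 2) - euler_partial_sum M (1 / t))"
  define g where "g = (\<lambda>t. 2 / t - euler_partial_sum M (1 / (t - 1)) - euler_partial_sum M (1 / (t + 1)))"
  have "((\<lambda>t::real. alt_hurwitz_zeta 1 ((t + 1) / 2)) \<longlongrightarrow> 0) at_top"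
  proof (rule filterlim_compose[OF alt_hurwitz_zeta_one_tendsto_0])
    have "filterlim (\<lambda>t::real. (1 / 2) * (1 + t)) at_top at_top"
      by (intro filterlim_tendsto_pos_mult_at_top[OF tendsto_const]
          filterlim_tendsto_add_at_top[OF tendsto_const] filterlim_ident) simp
    then show "filterlim (\<lambda>t::real. (t + 1) / 2) at_top at_top"
      by (simp add: add.commute)
  qed
  moreover have "((\<lambda>t. euler_partial_sum M (1 / t)) \<longlongrightarrow> (\<Sum>k\<le>M. euler_number (2 * k) * 0 ^ (2 * k + 1))) at_top"
    unfolding euler_partial_sum_def
    by (intro tendsto_sum tendsto_mult tendsto_const tendsto_power
        real_tendsto_divide_at_top[OF tendsto_const] filterlim_ident)
  ultimately have lim: "(R \<longlongrightarrow> 0) at_top"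
    unfolding R_def using tendsto_diff by fastforce
  have eq: "R t + R (t + 2) = g (t + 1)" if "t \<ge> T" for t
  proof -
    have "(t + 2 + 1) / 2 = (t + 1) / 2 + 1" "t + 1 - 1 = t" "t + 1 + 1 = t + 2"
      by (simp_all add: field_simps)
    moreover have "alt_hurwitz_zeta 1 ((t + 1) / 2) + alt_hurwitz_zeta 1 ((t + 1) / 2 + 1) = 2 / (t + 1)"
      using alt_hurwitz_zeta_one_shift[of "(t + 1) / 2"] that \<open>T > 1\<close> by simp
    ultimately show ?thesis
      by (simp only: R_def g_def)
  qed
  have g: "\<bar>g t\<bar> \<le> C / t ^ (2 * M + 1 + 2)" if "t \<ge> T" for t
  proof -
    have "2 * M + 1 + 2 = 2 * M + 3" by simp
    then show ?thesis using CT that by (simp only: g_def)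
  qed
  have bnd: "\<bar>R t\<bar> \<le> C / 2 / t ^ Suc (2 * M + 1)" if "t \<ge> T" for t
    using \<open>T > 1\<close> that by (intro decay_of_alternating_difference_equation[OF lim eq g]) auto
  have "2 * M + 2 = Suc (2 * M + 1)" by simp
  with bnd have "\<forall>t\<ge>T. \<bar>alt_hurwitz_zeta 1 ((t + 1) / 2) - euler_partial_sum M (1 / t)\<bar>
      \<le> C / 2 / t ^ (2 * M + 2)"
    by (simp only: R_def) blast
  with \<open>T > 1\<close> show thesis
    by (rule that)
qed

theorem mainTheorem8:
  shows "(\<forall>M::nat. (\<lambda>t::real. alt_hurwitz_zeta 1 ((t + 1) / 2)
              - (\<Sum>k=0..M. euler_number (2 * k) / t ^ (2 * k + 1)))
            \<in> o[at_top](\<lambda>t. 1 / t ^ (2 * M + 1)))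
       \<and> (\<forall>t::real. t > 0 \<longrightarrow> \<not> summable (\<lambda>k. euler_number (2 * k) / t ^ (2 * k + 1)))"
proof (intro conjI allI impI)
  fix M :: nat
  let ?R = "\<lambda>t::real. alt_hurwitz_zeta 1 ((t + 1) / 2) - euler_partial_sum M (1 / t)"
  obtain T C where T: "T > 1" and bound: "\<forall>t\<ge>T. \<bar>?R t\<bar> \<le> C / t ^ (2 * M + 2)"
    by (rule alt_hurwitz_zeta_one_euler_bound[where M = M])
  have "eventually (\<lambda>t. norm (?R t) \<le> C * norm (1 / t ^ (2 * M + 2))) at_top"
    using eventually_ge_at_top[of T]
  proof eventually_elim
    case (elim t)
    then have "norm (1 / t ^ (2 * M + 2)) = 1 / t ^ (2 * M + 2)"
      using T by (simp del: power_Suc)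
    moreover have "\<bar>?R t\<bar> \<le> C / t ^ (2 * M + 2)"
      using bound elim by blast
    ultimately show ?case by (simp only: real_norm_def times_divide_eq_right mult_1_right)
  qed
  then have "?R \<in> O[at_top](\<lambda>t. 1 / t ^ (2 * M + 2))"
    by (rule bigoI)
  also have "(\<lambda>t::real. 1 / t ^ (2 * M + 2)) \<in> o[at_top](\<lambda>t. 1 / t ^ (2 * M + 1))"
  proof (rule smalloI_tendsto)
    have "((\<lambda>t::real. 1 / t) \<longlongrightarrow> 0) at_top"
      by (intro real_tendsto_divide_at_top[OF tendsto_const] filterlim_ident)
    then show "((\<lambda>t::real. 1 / t ^ (2 * M + 2) / (1 / t ^ (2 * M + 1))) \<longlongrightarrow> 0) at_top"
      by (rule Lim_transform_eventually)
        (use eventually_gt_at_top[of 0] in eventually_elim, simp)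
    show "eventually (\<lambda>t::real. 1 / t ^ (2 * M + 1) \<noteq> 0) at_top"
      using eventually_gt_at_top[of 0] by eventually_elim simp
  qed
  also have "?R = (\<lambda>t. alt_hurwitz_zeta 1 ((t + 1) / 2)
              - (\<Sum>k=0..M. euler_number (2 * k) / t ^ (2 * k + 1)))"
    by (simp add: euler_partial_sum_def atLeast0AtMost power_one_over)
  finally show "(\<lambda>t::real. alt_hurwitz_zeta 1 ((t + 1) / 2)
              - (\<Sum>k=0..M. euler_number (2 * k) / t ^ (2 * k + 1)))
            \<in> o[at_top](\<lambda>t. 1 / t ^ (2 * M + 1))"
    .
qed (rule not_summable_euler_series)

end
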